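(* Let $N$ be an antilattice that is both regular and odd. Then $N$ is trivial, that is, $|N|=1$.
   Context: An antilattice $(N,\land,\lor)$ is a nonempty set $N$ (not necessarily finite) with two associative idempotent binary operations satisfying $x\land y\land x=x$ and $x\lor y\lor x=x$ for all $x,y$. A subantilattice is a nonempty subset closed under both operations. $N$ is odd if it has no subantilattice with exactly $2$ elements. For a band $(B,\cdot)$ (idempotent semigroup), Green's relations are defined by $x\,\mathcal{L}\,y\iff (xy=x$ and $yx=y)$ and $x\,\mathcal{R}\,y\iff (xy=y$ and $yx=x)$. An antilattice is regular if all four relations, namely $\mathcal{L}$ and $\mathcal{R}$ for the band $(N,\land)$ and $\mathcal{L}$ and $\mathcal{R}$ for the band $(N,\lor)$, are congruences with respect to both operations $\land$ and $\lor$. *)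

theory Defs
  imports Main
begin

locale band =
  fixes B :: "'a set" and mult :: "'a \<Rightarrow> 'a \<Rightarrow> 'a"
  assumes closed: "\<lbrakk>x \<in> B; y \<in> B\<rbrakk> \<Longrightarrow> mult x y \<in> B"
    and assoc: "\<lbrakk>x \<in> B; y \<in> B; z \<in> B\<rbrakk> \<Longrightarrow> mult (mult x y) z = mult x (mult y z)"
    and idem: "x \<in> B \<Longrightarrow> mult x x = x"

locale antilattice =
  meet: band N meet + join: band N join
  for N :: "'a set"
    and meet :: "'a \<Rightarrow> 'a \<Rightarrow> 'a"  (infixl \<open>\<sqinter>\<close> 70)
    and join :: "'a \<Rightarrow> 'a \<Rightarrow> 'a"  (infixl \<open>\<squnion>\<close> 65) +
  assumes nonempty: "N \<noteq> {}"
    and meet_rect: "\<lbrakk>x \<in> N; y \<in> N\<rbrakk> \<Longrightarrow> x \<sqinter> y \<sqinter> x = x"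
    and join_rect: "\<lbrakk>x \<in> N; y \<in> N\<rbrakk> \<Longrightarrow> x \<squnion> y \<squnion> x = x"

definition subantilattice ::
    "'a set \<Rightarrow> 'a set \<Rightarrow> ('a \<Rightarrow> 'a \<Rightarrow> 'a) \<Rightarrow> ('a \<Rightarrow> 'a \<Rightarrow> 'a) \<Rightarrow> bool" where
  "subantilattice S N meet join \<longleftrightarrow>
     S \<subseteq> N \<and> S \<noteq> {} \<and> (\<forall>x\<in>S. \<forall>y\<in>S. meet x y \<in> S \<and> join x y \<in> S)"

definition odd_antilattice ::
    "'a set \<Rightarrow> ('a \<Rightarrow> 'a \<Rightarrow> 'a) \<Rightarrow> ('a \<Rightarrow> 'a \<Rightarrow> 'a) \<Rightarrow> bool" where
  "odd_antilattice N meet join \<longleftrightarrow>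
     antilattice N meet join \<and> \<not> (\<exists>S. subantilattice S N meet join \<and> card S = 2)"

definition green_L :: "'a set \<Rightarrow> ('a \<Rightarrow> 'a \<Rightarrow> 'a) \<Rightarrow> ('a \<times> 'a) set" where
  "green_L B mult = {(x, y). x \<in> B \<and> y \<in> B \<and> mult x y = x \<and> mult y x = y}"

definition green_R :: "'a set \<Rightarrow> ('a \<Rightarrow> 'a \<Rightarrow> 'a) \<Rightarrow> ('a \<times> 'a) set" where
  "green_R B mult = {(x, y). x \<in> B \<and> y \<in> B \<and> mult x y = y \<and> mult y x = x}"

definition congruence_wrt ::
    "'a set \<Rightarrow> ('a \<Rightarrow> 'a \<Rightarrow> 'a) \<Rightarrow> ('a \<times> 'a) set \<Rightarrow> bool" where
  "congruence_wrt A f r \<longleftrightarrow>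
     equiv A r \<and>
     (\<forall>x x' y y'. (x, x') \<in> r \<longrightarrow> (y, y') \<in> r \<longrightarrow> (f x y, f x' y') \<in> r)"

definition regular_antilattice ::
    "'a set \<Rightarrow> ('a \<Rightarrow> 'a \<Rightarrow> 'a) \<Rightarrow> ('a \<Rightarrow> 'a \<Rightarrow> 'a) \<Rightarrow> bool" where
  "regular_antilattice N meet join \<longleftrightarrow>
     antilattice N meet join \<and>
     (\<forall>r \<in> {green_L N meet, green_R N meet, green_L N join, green_R N join}.
        congruence_wrt N meet r \<and> congruence_wrt N join r)"

end

theory Submission
  imports Defs
begin

text \<open>
  In a rectangular band any two elements \<open>a\<close>, \<open>b\<close> are linked by \<open>a \<R> ab \<L> b\<close>.
  If \<open>a\<close> and \<open>b\<close> are Green-related both for meet and for join, then \<open>{a, b}\<close> is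
  closed under both operations, so \<open>a = b\<close> by oddness. If they are related by a Green relation
  \<open>r\<close> of meet only, put \<open>c = a \<squnion> b\<close>: as \<open>r\<close> is a congruence for join,
  \<open>c\<close> is \<open>r\<close>-related to \<open>a \<squnion> a = a\<close> and to \<open>b\<close>, and linking \<open>a\<close> and \<open>b\<close> through \<open>c\<close>
  gives \<open>a = c = b\<close>. Linking arbitrary \<open>a\<close> and \<open>b\<close> through \<open>a \<sqinter> b\<close> then gives \<open>a = b\<close>.
\<close>

text \<open>A plain union, in general not transitive: on a rectangular band its transitive closure
  is the full relation.\<close>

definition green_LR :: "'a set \<Rightarrow> ('a \<Rightarrow> 'a \<Rightarrow> 'a) \<Rightarrow> ('a \<times> 'a) set" where
  "green_LR B f = green_L B f \<union> green_R B f"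

lemma (in band) green_LR_pair_closed:
  assumes "(x, y) \<in> green_LR B mult" and "u \<in> {x, y}" and "v \<in> {x, y}"
  shows "mult u v \<in> {x, y}"
  using assms idem by (auto simp: green_LR_def green_L_def green_R_def)

text \<open>\<open>band\<close> has no rectangular law, so the instance needed is a hypothesis,
  discharged later by \<open>meet_rect\<close> or \<open>join_rect\<close>.\<close>

lemma (in band) green_R_mult_right:
  assumes "a \<in> B" "b \<in> B" "mult (mult a b) a = a"
  shows "(a, mult a b) \<in> green_R B mult"
  using assms closed idem assoc[of a a b] by (simp add: green_R_def)

lemma (in band) green_L_mult_left:
  assumes "a \<in> B" "b \<in> B" "mult (mult b a) b = b"
  shows "(mult a b, b) \<in> green_L B mult"
  using assms closed idem assoc[of a b b] assoc[of b a b] by (simp add: green_L_def)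

lemma (in antilattice) odd_green_LR_eq:
  assumes odd: "odd_antilattice N meet join"
    and m: "(x, y) \<in> green_LR N meet" and j: "(x, y) \<in> green_LR N join"
  shows "x = y"
proof (rule ccontr)
  assume "x \<noteq> y"
  then have "card {x, y} = 2"
    by simp
  moreover have "{x, y} \<subseteq> N"
    using m by (auto simp: green_LR_def green_L_def green_R_def)
  then have "subantilattice {x, y} N meet join"
    using meet.green_LR_pair_closed[OF m] join.green_LR_pair_closed[OF j]
    unfolding subantilattice_def by blast
  ultimately show False
    using odd unfolding odd_antilattice_def by blast
qed

text \<open>Keeping \<open>r\<close> general lets one argument cover both
  \<open>green_L N meet\<close> and \<open>green_R N meet\<close>.\<close>

lemma (in antilattice) odd_green_meet_eq:
  assumes odd: "odd_antilattice N meet join"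
    and sub: "r \<subseteq> green_LR N meet" and cong: "congruence_wrt N join r"
    and ab: "(a, b) \<in> r"
  shows "a = b"
proof -
  have eq: "equiv N r"
    using cong by (simp add: congruence_wrt_def)
  have compat: "(x \<squnion> y, x' \<squnion> y') \<in> r" if "(x, x') \<in> r" "(y, y') \<in> r" for x x' y y'
    using cong that unfolding congruence_wrt_def by blast
  have N: "a \<in> N" "b \<in> N"
    using ab sub by (auto simp: green_LR_def green_L_def green_R_def)
  have refl: "(a, a) \<in> r" "(b, b) \<in> r"
    using eq N by (auto simp: equiv_def refl_on_def)
  have "(a, a \<squnion> b) \<in> r" "(a \<squnion> b, b) \<in> r"
    using compat[OF refl(1) ab] compat[OF ab refl(2)] N join.idem by simp_all
  moreover have "(a, a \<squnion> b) \<in> green_LR N join" "(a \<squnion> b, b) \<in> green_LR N join"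
    using join.green_R_mult_right join.green_L_mult_left N join_rect
    by (simp_all add: green_LR_def)
  ultimately have "a = a \<squnion> b" "a \<squnion> b = b"
    using odd_green_LR_eq[OF odd] sub by blast+
  then show "a = b"
    by simp
qed

theorem theorem7p10:
  fixes N :: "'a set" and meet join :: "'a \<Rightarrow> 'a \<Rightarrow> 'a"
  assumes "antilattice N meet join"
    and "regular_antilattice N meet join"
    and "odd_antilattice N meet join"
  shows "card N = 1"
proof -
  interpret antilattice N meet join
    by fact
  have cong: "congruence_wrt N join (green_L N meet)" "congruence_wrt N join (green_R N meet)"
    using assms(2) by (simp_all add: regular_antilattice_def)
  have "a = b" if "a \<in> N" "b \<in> N" for a b
  proof -
    \<comment> \<open>This link lies in \<open>green_R N meet\<close>, the next one in
      \<open>green_L N meet\<close>.\<close>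
    have "a = meet a b"
      using odd_green_meet_eq[OF assms(3) _ cong(2)] meet.green_R_mult_right that meet_rect
      by (simp add: green_LR_def)
    also have "\<dots> = b"
      using odd_green_meet_eq[OF assms(3) _ cong(1)] meet.green_L_mult_left that meet_rect
      by (simp add: green_LR_def)
    finally show ?thesis .
  qed
  then obtain a where "N = {a}"
    using nonempty by blast
  then show ?thesis
    by simp
qed

end
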